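(* Let $A$ be an annulus, and let $L\subset A\times I$ be an annular link. Then $\mathrm{MKh}(L\subset A\times I)\cong\mathrm{AKh}(L)$.
   Context: Setting. All links are oriented and considered up to ambient isotopy. $I=[0,1]$; the annulus is $A=\mathbb D^2\setminus\{*\}$, a disk with one puncture. For a disk with $n$ punctures $\Sigma$, a diagram $D\subset\Sigma$ of a link $L\subset\Sigma\times I$ is a generic projection of $L$ to $\Sigma$ with crossing data; it is also a diagram in $\mathbb R^2$ via $\Sigma\hookrightarrow\mathbb R^2$. Khovanov complex over $\mathbb Q$. Order the crossings $c_1,\dots,c_N$ of $D$. The $0$-resolution (resp. $1$-resolution) of a crossing joins the two regions swept out when the overstrand is rotated counterclockwise (resp. clockwise) until it meets the understrand. For $S\in\{0,1\}^N$, $D(S)$ is the collection of circles obtained by replacing each $c_i$ by its $S_i$-resolution. Let $V=\mathbb Q\langle v_+,v_-\rangle$, with quantum degrees $+1,-1$. If $D(S)$ has $k$ circles put $\mathrm{CKh}(D(S))=V^{\otimes k}$; its generators are enhanced states $\{(C_i,s_i)\}_i$, labelings of the circles $C_i$ by signs $s_i\in\{+,-\}$. With $n_\pm$ the numbers of positive/negative crossings, $\mathrm{wr}(D)=n_+-n_-$, $|S|=\sum_iS_i$, $$\mathrm{CKh}(D)=\bigoplus_{S}\mathrm{CKh}(D(S))[|S|-n_-]\{|S|-n_-+\mathrm{wr}(D)\},$$ where $[\cdot]$ and $\{\cdot\}$ are shifts of the homological and quantum gradings, $M[i]_m=M_{m-i}$, $M\{i\}_m=M_{m-i}$. If $S'$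 is obtained from $S$ by changing one $0$ (in position $j$) to $1$, then $\partial_{S,S'}$ is the merge map ($v_+\otimes v_+\mapsto v_+$, $v_+\otimes v_-,\,v_-\otimes v_+\mapsto v_-$, $v_-\otimes v_-\mapsto 0$) or the split map ($v_+\mapsto v_+\otimes v_-+v_-\otimes v_+$, $v_-\mapsto v_-\otimes v_-$) on the affected factors and the identity on the others; $\partial=\sum(-1)^{\sum_{i<j}S_i}\partial_{S,S'}$. For a filtration $\mathcal F$ of a complex $C$ by a poset, $\mathrm{gr}(C)=\bigoplus_a\mathcal F_aC/\sum_{b<a}\mathcal F_bC$ with the induced differential. $\mathrm{MKh}$. For an enhanced state $x=\{(C_i,s_i)\}_i$ set $g^\Sigma(x)=\sum_is_i[C_i]\in H_1(\Sigma;\mathbb Z)$, circles oriented counterclockwise. Identify $H_1(\Sigma;\mathbb Z)\cong\mathbb Z^n$ via positively oriented loops around the punctures, with the product partial order. $\mathcal F^\Sigma_a$ is the span of generators $x$ with $g^\Sigma(x)\le a$ (it is preserved by $\partial$), and $\mathrm{MKh}(L\subset\Sigma\times I)=H^*(\mathrm{gr}(\mathrm{CKh}(D),\partial,\mathcal F^\Sigma))$. $\mathrm{AKh}$. For a diagram $D\subset A$, set $k(x)=\sum_is_i[C_i]\in H_1(A;\mathbb Z)\cong\mathbb Z$. The spans of the generators with $k(x)\le a$, $a\in\mathbb Z$, form a $\mathbb Z$-filtration of $(\mathrm{CKh}(D),\partial)$, and annular Khovanov homology $\mathrm{AKh}(L)$ is the homology of the associated graded complex. *)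

theory Defs
  imports "HOL-Complex_Analysis.Complex_Analysis" "HOL-Homology.Homology"
begin

section \<open>Links in thickened punctured disks and their diagrams\<close>

text \<open>The disk is the closed unit disk in the complex plane, \<open>P\<close> is the finite set of its punctures
  (interior points). Components of a link are 1-periodic parametrizations, which orient it.\<close>

definition punctured_disk :: "complex set \<Rightarrow> complex set" where
  "punctured_disk P = cball 0 1 - P"

definition thickened :: "complex set \<Rightarrow> (complex \<times> real) set" where
  "thickened P = punctured_disk P \<times> {0..1}"

definition smooth_curve :: "(real \<Rightarrow> 'a::real_normed_vector) \<Rightarrow> bool" where
  "smooth_curve \<gamma> \<longleftrightarrow>
     (\<forall>n t. ((\<lambda>f t. vector_derivative f (at t)) ^^ n) \<gamma> differentiable (at t))"

definition smooth_closed_immersion :: "(real \<Rightarrow> 'a::real_normed_vector) \<Rightarrow> bool" where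
  "smooth_closed_immersion \<gamma> \<longleftrightarrow>
     smooth_curve \<gamma> \<and> (\<forall>t. \<gamma> (t + 1) = \<gamma> t) \<and> (\<forall>t. vector_derivative \<gamma> (at t) \<noteq> 0)"

type_synonym link = "(real \<Rightarrow> complex \<times> real) list"

text \<open>A point of the parameter space is \<open>(j, t)\<close>: component number and time.\<close>

definition params :: "'a list \<Rightarrow> (nat \<times> real) set" where
  "params L = {..<length L} \<times> {0..<1}"

definition is_link :: "complex set \<Rightarrow> link \<Rightarrow> bool" where
  "is_link P L \<longleftrightarrow>
     (\<forall>K\<in>set L. smooth_closed_immersion K \<and> range K \<subseteq> thickened P) \<and>
     inj_on (\<lambda>(j, t). (L ! j) t) (params L)"

definition same_oriented_link :: "link \<Rightarrow> link \<Rightarrow> bool" where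
  "same_oriented_link L L' \<longleftrightarrow> length L = length L' \<and>
     (\<exists>\<pi>. bij_betw \<pi> {..<length L} {..<length L'} \<and>
       (\<forall>j<length L. \<exists>\<rho> :: real \<Rightarrow> real.
          continuous_on UNIV \<rho> \<and> strict_mono \<rho> \<and> (\<forall>t. \<rho> (t + 1) = \<rho> t + 1) \<and>
          (\<forall>t. (L ! j) t = (L' ! \<pi> j) (\<rho> t))))"

definition ambient_isotopic :: "complex set \<Rightarrow> link \<Rightarrow> link \<Rightarrow> bool" where
  "ambient_isotopic P L L' \<longleftrightarrow>
     (\<exists>H :: real \<Rightarrow> complex \<times> real \<Rightarrow> complex \<times> real.
        continuous_on ({0..1} \<times> thickened P) (\<lambda>(t, x). H t x) \<and>
        (\<forall>t\<in>{0..1}. \<exists>G. homeomorphism (thickened P) (thickened P) (H t) G) \<and>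
        (\<forall>x\<in>thickened P. H 0 x = x) \<and>
        same_oriented_link (map (\<lambda>K. H 1 \<circ> K) L) L')"

text \<open>The first two fields are the diagram: the projected curves, and for every crossing the
  parameter of the overstrand. The other two are the auxiliary choices made in building the Khovanov
  complex: an ordering of the crossings and, for each crossing, the radius of a small round disk in
  which it is resolved.\<close>

record diagram =
  curves :: "(real \<Rightarrow> complex) list"
  over_param :: "complex \<Rightarrow> nat \<times> real"
  crossing_list :: "complex list"
  radius :: "complex \<Rightarrow> real"

definition shadow :: "diagram \<Rightarrow> complex set" where
  "shadow D = (\<Union>\<gamma>\<in>set (curves D). range \<gamma>)"

definition params_at :: "diagram \<Rightarrow> complex \<Rightarrow> (nat \<times> real) set" where
  "params_at D z = {(j, t) \<in> params (curves D). (curves D ! j) t = z}"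

definition velocity :: "diagram \<Rightarrow> nat \<times> real \<Rightarrow> complex" where
  "velocity D x = vector_derivative (curves D ! fst x) (at (snd x))"

definition crossings :: "diagram \<Rightarrow> complex set" where
  "crossings D = {c. \<exists>x\<in>params_at D c. \<exists>y\<in>params_at D c. x \<noteq> y}"

definition under_param :: "diagram \<Rightarrow> complex \<Rightarrow> nat \<times> real" where
  "under_param D c = (THE x. x \<in> params_at D c \<and> x \<noteq> over_param D c)"

text \<open>\<open>cross_det v w > 0\<close> iff \<open>w\<close> lies counterclockwise from \<open>v\<close> by an angle in \<open>(0, \<pi>)\<close>.\<close>

definition cross_det :: "complex \<Rightarrow> complex \<Rightarrow> real" where
  "cross_det v w = Im (cnj v * w)"

definition positive_crossing :: "diagram \<Rightarrow> complex \<Rightarrow> bool" where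
  "positive_crossing D c \<longleftrightarrow> cross_det (velocity D (over_param D c)) (velocity D (under_param D c)) > 0"

text \<open>Times at which the strand passing at parameter \<open>x\<close> through the crossing \<open>c\<close>
  enters and leaves the resolution disk of \<open>c\<close>.\<close>

definition entry_time :: "diagram \<Rightarrow> complex \<Rightarrow> nat \<times> real \<Rightarrow> real" where
  "entry_time D c x = Sup {u. u \<le> snd x \<and> dist c ((curves D ! fst x) u) = radius D c}"

definition exit_time :: "diagram \<Rightarrow> complex \<Rightarrow> nat \<times> real \<Rightarrow> real" where
  "exit_time D c x = Inf {u. snd x \<le> u \<and> dist c ((curves D ! fst x) u) = radius D c}"

definition entry_point :: "diagram \<Rightarrow> complex \<Rightarrow> nat \<times> real \<Rightarrow> complex" where
  "entry_point D c x = (curves D ! fst x) (entry_time D c x)"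

definition exit_point :: "diagram \<Rightarrow> complex \<Rightarrow> nat \<times> real \<Rightarrow> complex" where
  "exit_point D c x = (curves D ! fst x) (exit_time D c x)"

definition strand :: "diagram \<Rightarrow> complex \<Rightarrow> nat \<times> real \<Rightarrow> complex set" where
  "strand D c x = (curves D ! fst x) ` {entry_time D c x <..< exit_time D c x}"

definition disk_ends :: "diagram \<Rightarrow> complex \<Rightarrow> complex set" where
  "disk_ends D c = {entry_point D c (over_param D c), exit_point D c (over_param D c),
                    entry_point D c (under_param D c), exit_point D c (under_param D c)}"

text \<open>The resolution disk contains no other crossing, and meets the diagram exactly in an
  overstrand and an understrand crossing it from boundary to boundary.\<close>

definition good_disk :: "complex set \<Rightarrow> diagram \<Rightarrow> complex \<Rightarrow> bool" where
  "good_disk P D c \<longleftrightarrow>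
     radius D c > 0 \<and> cball c (radius D c) \<subseteq> punctured_disk P \<and>
     crossings D \<inter> cball c (radius D c) = {c} \<and>
     shadow D \<inter> ball c (radius D c) = strand D c (over_param D c) \<union> strand D c (under_param D c) \<and>
     shadow D \<inter> sphere c (radius D c) = disk_ends D c \<and> card (disk_ends D c) = 4"

definition is_diagram :: "complex set \<Rightarrow> diagram \<Rightarrow> bool" where
  "is_diagram P D \<longleftrightarrow>
     (\<forall>\<gamma>\<in>set (curves D). smooth_closed_immersion \<gamma> \<and> range \<gamma> \<subseteq> punctured_disk P) \<and>
     finite (crossings D) \<and>
     (\<forall>c\<in>crossings D. card (params_at D c) = 2 \<and> over_param D c \<in> params_at D c \<and>
        cross_det (velocity D (over_param D c)) (velocity D (under_param D c)) \<noteq> 0 \<and> good_disk P D c) \<and>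
     (\<forall>c\<in>crossings D. \<forall>c'\<in>crossings D. c \<noteq> c' \<longrightarrow>
        cball c (radius D c) \<inter> cball c' (radius D c') = {}) \<and>
     distinct (crossing_list D) \<and> set (crossing_list D) = crossings D"

definition is_diagram_of :: "complex set \<Rightarrow> diagram \<Rightarrow> link \<Rightarrow> bool" where
  "is_diagram_of P D L \<longleftrightarrow> is_diagram P D \<and>
     (\<exists>L'. is_link P L' \<and> ambient_isotopic P L L' \<and> curves D = map (\<lambda>K. fst \<circ> K) L' \<and>
        (\<forall>c\<in>crossings D.
           snd ((L' ! fst (under_param D c)) (snd (under_param D c)))
           < snd ((L' ! fst (over_param D c)) (snd (over_param D c)))))"


section \<open>Resolutions\<close>

text \<open>Rotating the overstrand counterclockwise, its forward end first meets the end \<open>a\<close> of the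
  understrand and its backward end meets \<open>b\<close>. Joining the two regions swept out separates the other
  two, which are cut off by the chords from \<open>a\<close> to the backward end and from \<open>b\<close> to the forward end.\<close>

definition chords :: "diagram \<Rightarrow> bool \<Rightarrow> complex \<Rightarrow> complex set" where
  "chords D r1 c =
     (let fwd = exit_point D c (over_param D c); bwd = entry_point D c (over_param D c);
          (a, b) = (if positive_crossing D c
                    then (exit_point D c (under_param D c), entry_point D c (under_param D c))
                    else (entry_point D c (under_param D c), exit_point D c (under_param D c)))
      in if r1 then closed_segment a fwd \<union> closed_segment b bwd
         else closed_segment a bwd \<union> closed_segment b fwd)"

text \<open>\<open>S \<in> {0,1}\<^sup>N\<close> is encoded by the set of positions (in \<open>crossing_list D\<close>, counted from 0)
  carrying a \<open>1\<close>. The circles of \<open>D(S)\<close> are subsets of the plane.\<close>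

definition resolution :: "diagram \<Rightarrow> nat set \<Rightarrow> complex set" where
  "resolution D S =
     (shadow D - (\<Union>c\<in>crossings D. ball c (radius D c))) \<union>
     (\<Union>i<length (crossing_list D). chords D (i \<in> S) (crossing_list D ! i))"

definition circles :: "diagram \<Rightarrow> nat set \<Rightarrow> complex set set" where
  "circles D S = components (resolution D S)"


section \<open>Rational vector spaces\<close>

text \<open>Rational vector spaces are \<open>HOL-Algebra\<close> modules over \<open>rat_ring\<close>; the multiplicative fields
  that the record type inherits from rings are irrelevant.\<close>

definition rat_ring :: "rat ring" where
  "rat_ring = \<lparr>carrier = UNIV, mult = (*), one = 1, zero = 0, add = (+)\<rparr>"

definition rat_span :: "'x set \<Rightarrow> ('x \<Rightarrow> rat) set" where
  "rat_span B = {f. finite {x. f x \<noteq> 0} \<and> {x. f x \<noteq> 0} \<subseteq> B}"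

definition free_module :: "'x set \<Rightarrow> (rat, 'x \<Rightarrow> rat) module" where
  "free_module B = \<lparr>carrier = rat_span B, mult = undefined, one = undefined,
     zero = (\<lambda>x. 0), add = (\<lambda>f g x. f x + g x), smult = (\<lambda>c f x. c * f x)\<rparr>"

text \<open>The map of cosets induced by \<open>f\<close>, with target the quotient of \<open>M\<close> by \<open>U\<close>.\<close>

definition coset_map :: "(rat, 'v) module \<Rightarrow> 'v set \<Rightarrow> ('u \<Rightarrow> 'v) \<Rightarrow> 'u set \<Rightarrow> 'v set" where
  "coset_map M U f X = (\<Union>x\<in>X. U +>\<^bsub>M\<^esub> f x)"

definition quotient_module :: "(rat, 'v) module \<Rightarrow> 'v set \<Rightarrow> (rat, 'v set) module" where
  "quotient_module M U = \<lparr>carrier = a_rcosets\<^bsub>M\<^esub> U, mult = undefined, one = undefined,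
     zero = U, add = (\<lambda>X Y. X <+>\<^bsub>M\<^esub> Y), smult = (\<lambda>c. coset_map M U (\<lambda>x. c \<odot>\<^bsub>M\<^esub> x))\<rparr>"

definition direct_sum :: "'p set \<Rightarrow> ('p \<Rightarrow> (rat, 'v) module) \<Rightarrow> (rat, 'p \<Rightarrow> 'v) module" where
  "direct_sum I N =
     \<lparr>carrier = {\<xi> \<in> (\<Pi>\<^sub>E a\<in>I. carrier (N a)). finite {a \<in> I. \<xi> a \<noteq> \<zero>\<^bsub>N a\<^esub>}},
      mult = undefined, one = undefined,
      zero = (\<lambda>a\<in>I. \<zero>\<^bsub>N a\<^esub>), add = (\<lambda>\<xi> \<eta>. \<lambda>a\<in>I. \<xi> a \<oplus>\<^bsub>N a\<^esub> \<eta> a),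
      smult = (\<lambda>c \<xi>. \<lambda>a\<in>I. c \<odot>\<^bsub>N a\<^esub> \<xi> a)\<rparr>"

definition linear_iso :: "(rat, 'u) module \<Rightarrow> (rat, 'v) module \<Rightarrow> ('u \<Rightarrow> 'v) \<Rightarrow> bool" where
  "linear_iso M N \<phi> \<longleftrightarrow> bij_betw \<phi> (carrier M) (carrier N) \<and>
     (\<forall>x\<in>carrier M. \<forall>y\<in>carrier M. \<phi> (x \<oplus>\<^bsub>M\<^esub> y) = \<phi> x \<oplus>\<^bsub>N\<^esub> \<phi> y) \<and>
     (\<forall>c. \<forall>x\<in>carrier M. \<phi> (c \<odot>\<^bsub>M\<^esub> x) = c \<odot>\<^bsub>N\<^esub> \<phi> x)"


section \<open>Filtered complexes\<close>

text \<open>A cochain complex is a family of modules \<open>C i\<close> with differentials \<open>d i\<close> from \<open>C i\<close> to \<open>C (i+1)\<close>.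
  A filtration of it by the poset \<open>I\<close> is a family of submodules \<open>F i a\<close> of \<open>C i\<close>, \<open>a \<in> I\<close>.\<close>

definition cohomology ::
  "(int \<Rightarrow> (rat, 'v) module) \<Rightarrow> (int \<Rightarrow> 'v \<Rightarrow> 'v) \<Rightarrow> int \<Rightarrow> (rat, 'v set) module" where
  "cohomology C d i =
     quotient_module ((C i)\<lparr>carrier := {x \<in> carrier (C i). d i x = \<zero>\<^bsub>C (i + 1)\<^esub>}\<rparr>)
       (d (i - 1) ` carrier (C (i - 1)))"

definition filt_below :: "(rat, 'v) module \<Rightarrow> ('p::order \<Rightarrow> 'v set) \<Rightarrow> 'p set \<Rightarrow> 'p \<Rightarrow> 'v set" where
  "filt_below M F I a = \<Inter> {U. submodule U rat_ring M \<and> (\<Union>b\<in>{b \<in> I. b < a}. F b) \<subseteq> U}"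

definition gr ::
  "(int \<Rightarrow> (rat, 'v) module) \<Rightarrow> (int \<Rightarrow> 'p::order \<Rightarrow> 'v set) \<Rightarrow> 'p set
     \<Rightarrow> int \<Rightarrow> (rat, 'p \<Rightarrow> 'v set) module" where
  "gr C F I i =
     direct_sum I (\<lambda>a. quotient_module ((C i)\<lparr>carrier := F i a\<rparr>) (filt_below (C i) (F i) I a))"

definition gr_diff ::
  "(int \<Rightarrow> (rat, 'v) module) \<Rightarrow> (int \<Rightarrow> 'v \<Rightarrow> 'v) \<Rightarrow> (int \<Rightarrow> 'p::order \<Rightarrow> 'v set) \<Rightarrow> 'p set
     \<Rightarrow> int \<Rightarrow> ('p \<Rightarrow> 'v set) \<Rightarrow> ('p \<Rightarrow> 'v set)" where
  "gr_diff C d F I i \<xi> =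
     (\<lambda>a\<in>I. coset_map (C (i + 1)) (filt_below (C (i + 1)) (F (i + 1)) I a) (d i) (\<xi> a))"

definition gr_cohomology ::
  "(int \<Rightarrow> (rat, 'v) module) \<Rightarrow> (int \<Rightarrow> 'v \<Rightarrow> 'v) \<Rightarrow> (int \<Rightarrow> 'p::order \<Rightarrow> 'v set) \<Rightarrow> 'p set
     \<Rightarrow> int \<Rightarrow> (rat, ('p \<Rightarrow> 'v set) set) module" where
  "gr_cohomology C d F I i = cohomology (gr C F I) (gr_diff C d F I) i"

text \<open>The summand of degree \<open>a\<close>: classes represented by cocycles concentrated in degree \<open>a\<close>.\<close>

definition gr_cohomology_part ::
  "(int \<Rightarrow> (rat, 'v) module) \<Rightarrow> (int \<Rightarrow> 'v \<Rightarrow> 'v) \<Rightarrow> (int \<Rightarrow> 'p::order \<Rightarrow> 'v set) \<Rightarrow> 'p set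
     \<Rightarrow> int \<Rightarrow> 'p \<Rightarrow> ('p \<Rightarrow> 'v set) set set" where
  "gr_cohomology_part C d F I i a =
     {h \<in> carrier (gr_cohomology C d F I i).
        \<exists>\<xi>\<in>h. \<forall>b\<in>I - {a}. \<xi> b = filt_below (C i) (F i) I b}"


section \<open>The Khovanov complex\<close>

datatype sign = Plus | Minus

fun sign_val :: "sign \<Rightarrow> int" where
  "sign_val Plus = 1"
| "sign_val Minus = -1"

text \<open>An enhanced state is a vertex \<open>S\<close> of the cube together with a labeling of the circles of \<open>D(S)\<close>.\<close>

type_synonym state = "nat set \<times> (complex set \<Rightarrow> sign)"

definition states :: "diagram \<Rightarrow> state set" where
  "states D = {(S, s). S \<subseteq> {..<length (crossing_list D)} \<and> s \<in> circles D S \<rightarrow>\<^sub>E UNIV}"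

definition n_plus :: "diagram \<Rightarrow> int" where
  "n_plus D = int (card {c \<in> crossings D. positive_crossing D c})"

definition n_minus :: "diagram \<Rightarrow> int" where
  "n_minus D = int (card {c \<in> crossings D. \<not> positive_crossing D c})"

definition writhe :: "diagram \<Rightarrow> int" where
  "writhe D = n_plus D - n_minus D"

fun hom_degree :: "diagram \<Rightarrow> state \<Rightarrow> int" where
  "hom_degree D (S, s) = int (card S) - n_minus D"

fun quantum_degree :: "diagram \<Rightarrow> state \<Rightarrow> int" where
  "quantum_degree D (S, s) =
     (\<Sum>C\<in>circles D S. sign_val (s C)) + (int (card S) - n_minus D + writhe D)"

definition bistates :: "diagram \<Rightarrow> int \<Rightarrow> int \<Rightarrow> state set" where
  "bistates D i j = {x \<in> states D. hom_degree D x = i \<and> quantum_degree D x = j}"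

definition CKh :: "diagram \<Rightarrow> int \<Rightarrow> int \<Rightarrow> (rat, state \<Rightarrow> rat) module" where
  "CKh D i j = free_module (bistates D i j)"

text \<open>\<open>(u, v, w)\<close> is listed iff \<open>w\<close> occurs (with coefficient 1) in the image of \<open>u \<otimes> v\<close>.\<close>

definition merge_terms :: "(sign \<times> sign \<times> sign) set" where
  "merge_terms = {(Plus, Plus, Plus), (Plus, Minus, Minus), (Minus, Plus, Minus)}"

text \<open>\<open>(u, v, w)\<close> is listed iff \<open>v \<otimes> w\<close> occurs (with coefficient 1) in the image of \<open>u\<close>.\<close>

definition split_terms :: "(sign \<times> sign \<times> sign) set" where
  "split_terms = {(Plus, Plus, Minus), (Plus, Minus, Plus), (Minus, Minus, Minus)}"

text \<open>Whether the labeling \<open>s'\<close> of \<open>D(S')\<close> occurs in the image of the labeling \<open>s\<close> of \<open>D(S)\<close> under the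
  edge map. The circles not affected by the change of resolution are those common to both.\<close>

definition edge_term :: "diagram \<Rightarrow> state \<Rightarrow> state \<Rightarrow> bool" where
  "edge_term D x y \<longleftrightarrow>
     (let (S, s) = x; (S', s') = y;
          before = circles D S - circles D S'; after = circles D S' - circles D S
      in (\<forall>C\<in>circles D S \<inter> circles D S'. s' C = s C) \<and>
         ((\<exists>C1 C2 C. C1 \<noteq> C2 \<and> before = {C1, C2} \<and> after = {C} \<and>
                     (s C1, s C2, s' C) \<in> merge_terms) \<or>
          (\<exists>C C1 C2. C1 \<noteq> C2 \<and> before = {C} \<and> after = {C1, C2} \<and>
                     (s C, s' C1, s' C2) \<in> split_terms)))"

definition diff_coeff :: "diagram \<Rightarrow> state \<Rightarrow> state \<Rightarrow> rat" where
  "diff_coeff D x y =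
     (\<Sum>j | j < length (crossing_list D) \<and> j \<notin> fst x \<and> fst y = insert j (fst x).
        (-1) ^ card {i \<in> fst x. i < j} * of_bool (edge_term D x y))"

definition differential :: "diagram \<Rightarrow> (state \<Rightarrow> rat) \<Rightarrow> state \<Rightarrow> rat" where
  "differential D f y =
     (if y \<in> states D then \<Sum>x | f x \<noteq> 0. f x * diff_coeff D x y else 0)"


section \<open>Homology classes of enhanced states\<close>

text \<open>A loop \<open>g\<close> on \<open>[0,1]\<close> as a singular 1-simplex.\<close>

definition loop_simplex :: "(real \<Rightarrow> complex) \<Rightarrow> (nat \<Rightarrow> real) \<Rightarrow> complex" where
  "loop_simplex g = restrict (\<lambda>x. g (x 1)) (standard_simplex 1)"

definition ccw_loop :: "complex set \<Rightarrow> real \<Rightarrow> complex" where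
  "ccw_loop C = (SOME g. simple_path g \<and> pathfinish g = pathstart g \<and> path_image g = C \<and>
                         (\<forall>z\<in>inside C. winding_number g z = 1))"

definition puncture_loop :: "complex set \<Rightarrow> complex \<Rightarrow> real \<Rightarrow> complex" where
  "puncture_loop P q =
     circlepath q (SOME r. 0 < r \<and> cball q r \<subseteq> ball 0 1 \<and> cball q r \<inter> P = {q})"

text \<open>The class of a singular 1-cycle, an element of
  \<open>carrier (homology_group 1 (top_of_set (punctured_disk P)))\<close>.\<close>

definition H1_class :: "complex set \<Rightarrow> complex chain \<Rightarrow> complex chain set" where
  "H1_class P z = homologous_rel_set 1 (top_of_set (punctured_disk P)) {} z"

definition state_class :: "complex set \<Rightarrow> diagram \<Rightarrow> state \<Rightarrow> complex chain set" where
  "state_class P D x = H1_class P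
     (\<Sum>C\<in>circles D (fst x). frag_cmul (sign_val (snd x C)) (frag_of (loop_simplex (ccw_loop C))))"

text \<open>\<open>\<int>\<^sup>P\<close>, with the order of functions, i.e. the product order; and the identification of it with
  \<open>H\<^sub>1\<close> of the punctured disk.\<close>

definition lattice_of :: "complex set \<Rightarrow> (complex \<Rightarrow> int) set" where
  "lattice_of P = {a. \<forall>q. q \<notin> P \<longrightarrow> a q = 0}"

definition lattice_class :: "complex set \<Rightarrow> (complex \<Rightarrow> int) \<Rightarrow> complex chain set" where
  "lattice_class P a = H1_class P
     (\<Sum>q\<in>P. frag_cmul (a q) (frag_of (loop_simplex (puncture_loop P q))))"


section \<open>The homology theories\<close>

definition MKh_filtration ::
  "complex set \<Rightarrow> diagram \<Rightarrow> int \<Rightarrow> int \<Rightarrow> (complex \<Rightarrow> int) \<Rightarrow> (state \<Rightarrow> rat) set" where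
  "MKh_filtration P D j i a = rat_span {x \<in> bistates D i j.
     \<exists>b\<in>lattice_of P. state_class P D x = lattice_class P b \<and> b \<le> a}"

text \<open>Here \<open>i\<close> is the homological and \<open>j\<close> the quantum degree.\<close>

definition MKh ::
  "complex set \<Rightarrow> diagram \<Rightarrow> int \<Rightarrow> int \<Rightarrow> (rat, ((complex \<Rightarrow> int) \<Rightarrow> (state \<Rightarrow> rat) set) set) module"
  where
  "MKh P D i j = gr_cohomology (\<lambda>i. CKh D i j) (\<lambda>i. differential D)
     (MKh_filtration P D j) (lattice_of P) i"

definition MKh_part ::
  "complex set \<Rightarrow> diagram \<Rightarrow> int \<Rightarrow> int \<Rightarrow> (complex \<Rightarrow> int)
     \<Rightarrow> ((complex \<Rightarrow> int) \<Rightarrow> (state \<Rightarrow> rat) set) set set" where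
  "MKh_part P D i j a = gr_cohomology_part (\<lambda>i. CKh D i j) (\<lambda>i. differential D)
     (MKh_filtration P D j) (lattice_of P) i a"

text \<open>For the annulus with puncture \<open>p\<close>, whose \<open>H\<^sub>1\<close> is identified with \<open>\<int>\<close> by a positively oriented
  loop around \<open>p\<close>.\<close>

definition AKh_filtration ::
  "complex \<Rightarrow> diagram \<Rightarrow> int \<Rightarrow> int \<Rightarrow> int \<Rightarrow> (state \<Rightarrow> rat) set" where
  "AKh_filtration p D j i a = rat_span {x \<in> bistates D i j.
     \<exists>k. state_class {p} D x =
           H1_class {p} (frag_cmul k (frag_of (loop_simplex (puncture_loop {p} p)))) \<and> k \<le> a}"

definition AKh ::
  "complex \<Rightarrow> diagram \<Rightarrow> int \<Rightarrow> int \<Rightarrow> (rat, (int \<Rightarrow> (state \<Rightarrow> rat) set) set) module" where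
  "AKh p D i j = gr_cohomology (\<lambda>i. CKh D i j) (\<lambda>i. differential D)
     (AKh_filtration p D j) UNIV i"

definition AKh_part ::
  "complex \<Rightarrow> diagram \<Rightarrow> int \<Rightarrow> int \<Rightarrow> int \<Rightarrow> (int \<Rightarrow> (state \<Rightarrow> rat) set) set set" where
  "AKh_part p D i j a = gr_cohomology_part (\<lambda>i. CKh D i j) (\<lambda>i. differential D)
     (AKh_filtration p D j) UNIV i a"

end

theory Submission
  imports Defs
begin

text \<open>Since \<open>lattice_of {p}\<close> is order isomorphic to \<open>\<int>\<close> by \<open>a \<mapsto> a p\<close>, and \<open>lattice_class {p} a\<close> is
  \<open>a p\<close> times the class of the loop around \<open>p\<close>, the two theories are built from the same filtration of
  the same complex, up to the choice of the indexing poset. Precomposition with the order isomorphism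
  therefore identifies the associated graded complexes and their cohomologies.\<close>

definition reindex :: "('q \<Rightarrow> 'p) \<Rightarrow> 'q set \<Rightarrow> ('p \<Rightarrow> 'v) \<Rightarrow> 'q \<Rightarrow> 'v" where
  "reindex e J \<xi> = (\<lambda>k\<in>J. \<xi> (e k))"

text \<open>Surjectivity of \<open>e\<close> recovers all values on \<open>I\<close>, and
  extensionality fixes the others. Stating this on \<open>extensional I\<close> also covers families
  not known to lie in a carrier.\<close>

lemma inj_on_reindex:
  assumes "e ` J = I"
  shows "inj_on (reindex e J) (extensional I)"
proof (rule inj_onI)
  fix \<xi> \<eta> :: "_ \<Rightarrow> _"
  assume ext: "\<xi> \<in> extensional I" "\<eta> \<in> extensional I" and eq: "reindex e J \<xi> = reindex e J \<eta>"
  show "\<xi> = \<eta>"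
  proof (rule extensionalityI[OF ext])
    fix a assume "a \<in> I"
    then obtain k where "k \<in> J" "a = e k" using assms by blast
    then show "\<xi> a = \<eta> a" using fun_cong[OF eq, of k] by (simp add: reindex_def)
  qed
qed

lemma bij_betw_reindex_direct_sum:
  assumes e: "bij_betw e J I" and N: "\<And>k. k \<in> J \<Longrightarrow> N' k = N (e k)"
  shows "bij_betw (reindex e J) (carrier (direct_sum I N)) (carrier (direct_sum J N'))"
proof -
  have supp: "finite {k \<in> J. reindex e J \<xi> k \<noteq> \<zero>\<^bsub>N' k\<^esub>} \<longleftrightarrow> finite {a \<in> I. \<xi> a \<noteq> \<zero>\<^bsub>N a\<^esub>}" for \<xi>
  proof (rule bij_betw_finite)
    \<comment> \<open>\<open>N' k\<close> and \<open>N (e k)\<close> are the same module, so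
      \<open>e\<close> matches the two supports.\<close>
    show "bij_betw e {k \<in> J. reindex e J \<xi> k \<noteq> \<zero>\<^bsub>N' k\<^esub>} {a \<in> I. \<xi> a \<noteq> \<zero>\<^bsub>N a\<^esub>}"
      using e by (auto simp: bij_betw_def inj_on_def reindex_def N)
  qed
  have "inj_on (reindex e J) (carrier (direct_sum I N))"
    by (rule inj_on_subset[OF inj_on_reindex[OF bij_betw_imp_surj_on[OF e]]])
       (auto simp: direct_sum_def PiE_def)
  moreover have "reindex e J ` carrier (direct_sum I N) = carrier (direct_sum J N')"
  proof
    show "reindex e J ` carrier (direct_sum I N) \<subseteq> carrier (direct_sum J N')"
    proof
      fix \<eta> assume "\<eta> \<in> reindex e J ` carrier (direct_sum I N)"
      then obtain \<xi> where \<xi>: "\<xi> \<in> carrier (direct_sum I N)" and \<eta>: "\<eta> = reindex e J \<xi>" by blast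
      have "reindex e J \<xi> \<in> (\<Pi>\<^sub>E k\<in>J. carrier (N' k))"
        using \<xi> bij_betwE[OF e] by (auto simp: direct_sum_def reindex_def N)
      then show "\<eta> \<in> carrier (direct_sum J N')"
        using \<xi> supp[of \<xi>] by (simp add: direct_sum_def \<eta>)
    qed
  next
    show "carrier (direct_sum J N') \<subseteq> reindex e J ` carrier (direct_sum I N)"
    proof
      fix \<eta> assume \<eta>: "\<eta> \<in> carrier (direct_sum J N')"
      \<comment> \<open>The preimage is obtained by reindexing along the inverse of
        \<open>e\<close>; it is \<open>undefined\<close> off \<open>I\<close>, as
        \<open>direct_sum\<close> requires.\<close>
      define \<xi> where "\<xi> = reindex (the_inv_into J e) I \<eta>"
      have inv: "the_inv_into J e (e k) = k" if "k \<in> J" for k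
        using e that by (simp add: bij_betw_def the_inv_into_f_f)
      have "\<xi> (e k) = \<eta> k" if "k \<in> J" for k
        using that inv bij_betwE[OF e] by (simp add: \<xi>_def reindex_def)
      then have \<xi>\<eta>: "reindex e J \<xi> = \<eta>"
        using \<eta> by (auto simp: direct_sum_def reindex_def PiE_def extensional_def)
      have "\<xi> a \<in> carrier (N a)" if a: "a \<in> I" for a
      proof -
        obtain k where k: "k \<in> J" "a = e k" using a bij_betw_imp_surj_on[OF e] by blast
        then have "\<xi> a = \<eta> k" using \<xi>\<eta> by (auto simp: reindex_def)
        moreover have "\<eta> k \<in> carrier (N' k)" using \<eta> k by (auto simp: direct_sum_def)
        ultimately show ?thesis using N k by simp
      qed
      then have "\<xi> \<in> (\<Pi>\<^sub>E a\<in>I. carrier (N a))" by (auto simp: \<xi>_def reindex_def)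
      then have "\<xi> \<in> carrier (direct_sum I N)"
        using \<eta> supp[of \<xi>] by (simp add: direct_sum_def \<xi>\<eta>)
      then show "\<eta> \<in> reindex e J ` carrier (direct_sum I N)" using \<xi>\<eta> by blast
    qed
  qed
  ultimately show ?thesis by (simp add: bij_betw_def)
qed

text \<open>Both sides are restricted to \<open>J\<close> and agree pointwise there, so the
  identities hold for arbitrary families, the unconditional form that passing to quotients will
  require. The identity for zero serves to match cocycles.\<close>

lemma reindex_direct_sum_ops:
  assumes "e ` J \<subseteq> I" and "\<And>k. k \<in> J \<Longrightarrow> N' k = N (e k)"
  shows "reindex e J (\<xi> \<oplus>\<^bsub>direct_sum I N\<^esub> \<eta>) = reindex e J \<xi> \<oplus>\<^bsub>direct_sum J N'\<^esub> reindex e J \<eta>"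
    and "reindex e J (c \<odot>\<^bsub>direct_sum I N\<^esub> \<xi>) = c \<odot>\<^bsub>direct_sum J N'\<^esub> reindex e J \<xi>"
    and "reindex e J \<zero>\<^bsub>direct_sum I N\<^esub> = \<zero>\<^bsub>direct_sum J N'\<^esub>"
  using assms by (auto simp: reindex_def direct_sum_def fun_eq_iff)

text \<open>The operations of \<open>M\<close> and \<open>N\<close> are total functions, so asking for additivity everywhere, and for
  injectivity on a set \<open>E\<close> containing all sums, replaces all closure conditions on \<open>M\<close> and \<open>U\<close>.\<close>

lemma linear_iso_quotient_module:
  assumes bij: "bij_betw r (carrier M) (carrier N)"
    and add: "\<And>x y. r (x \<oplus>\<^bsub>M\<^esub> y) = r x \<oplus>\<^bsub>N\<^esub> r y"
    and smult: "\<And>c x. r (c \<odot>\<^bsub>M\<^esub> x) = c \<odot>\<^bsub>N\<^esub> r x"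
    and inj: "inj_on r E" and E: "\<And>x y. x \<oplus>\<^bsub>M\<^esub> y \<in> E"
  shows "linear_iso (quotient_module M U) (quotient_module N (r ` U)) ((`) r)"
    and "\<Union> (carrier (quotient_module M U)) \<subseteq> E"
proof -
  have coset: "r ` (U +>\<^bsub>M\<^esub> x) = r ` U +>\<^bsub>N\<^esub> r x" for x
    by (simp add: a_r_coset_def' image_UN add)
  show sub: "\<Union> (carrier (quotient_module M U)) \<subseteq> E"
    by (auto simp: quotient_module_def A_RCOSETS_def' a_r_coset_def' E)
  \<comment> \<open>Cosets with equal images are equal because \<open>r\<close> is injective on the
    union of all cosets, which lies in \<open>E\<close>.\<close>
  have "inj_on ((`) r) (carrier (quotient_module M U))"
    by (rule inj_on_image[OF inj_on_subset[OF inj sub]])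
  moreover have "(`) r ` carrier (quotient_module M U) = carrier (quotient_module N (r ` U))"
    unfolding quotient_module_def A_RCOSETS_def' partial_object.simps
      bij_betw_imp_surj_on[OF bij, symmetric] by (simp add: image_UN coset)
  ultimately show "linear_iso (quotient_module M U) (quotient_module N (r ` U)) ((`) r)"
    unfolding linear_iso_def bij_betw_def
    by (auto simp: quotient_module_def coset_map_def set_add_def' add smult image_UN coset
             simp flip: smult)
qed

text \<open>\<open>filt_below\<close> depends only on the union of the strictly lower steps, and
  \<open>e\<close> carries the elements of \<open>J\<close> below \<open>k\<close> onto those of
  \<open>I\<close> below \<open>e k\<close>.\<close>

lemma filt_below_reindex:
  assumes "e ` J = I" and "\<And>k l. k \<in> J \<Longrightarrow> l \<in> J \<Longrightarrow> e k \<le> e l \<longleftrightarrow> k \<le> l"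
    and "\<And>k. k \<in> J \<Longrightarrow> F' k = F (e k)" and "k \<in> J"
  shows "filt_below M F' J k = filt_below M F I (e k)"
proof -
  have "(\<Union>l\<in>{l \<in> J. l < k}. F' l) = (\<Union>b\<in>{b \<in> I. b < e k}. F b)"
    using assms by (auto simp: less_le_not_le)
  then show ?thesis by (simp add: filt_below_def)
qed

text \<open>The graded pieces at \<open>k\<close> and \<open>e k\<close> are literally the same
  module, so reindexing commutes with the graded differential and descends to cosets of boundaries.
  The second claim tracks the grading by filtration degree.\<close>

lemma gr_cohomology_reindex:
  fixes F :: "int \<Rightarrow> 'p::order \<Rightarrow> 'v set" and F' :: "int \<Rightarrow> 'q::order \<Rightarrow> 'v set"
  assumes e: "bij_betw e J I"
    and ord: "\<And>k l. k \<in> J \<Longrightarrow> l \<in> J \<Longrightarrow> e k \<le> e l \<longleftrightarrow> k \<le> l"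
    and F: "\<And>i k. k \<in> J \<Longrightarrow> F' i k = F i (e k)"
  shows "linear_iso (gr_cohomology C d F I i) (gr_cohomology C d F' J i) ((`) (reindex e J))"
    and "k \<in> J \<Longrightarrow> (`) (reindex e J) ` gr_cohomology_part C d F I i (e k)
           = gr_cohomology_part C d F' J i k"
proof -
  let ?r = "reindex e J :: ('p \<Rightarrow> 'v set) \<Rightarrow> _"
  have img: "e ` J = I" using e by (simp add: bij_betw_def)
  have below: "filt_below M (F' i) J k = filt_below M (F i) I (e k)" if "k \<in> J" for M i k
    using img ord F that by (rule filt_below_reindex)
  let ?N = "\<lambda>i a. quotient_module ((C i)\<lparr>carrier := F i a\<rparr>) (filt_below (C i) (F i) I a)"
  let ?N' = "\<lambda>i a. quotient_module ((C i)\<lparr>carrier := F' i a\<rparr>) (filt_below (C i) (F' i) J a)"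
  have N: "?N' i k = ?N i (e k)" if "k \<in> J" for i k using below[OF that] F[OF that] by simp
  have bij: "bij_betw ?r (carrier (gr C F I i)) (carrier (gr C F' J i))" for i
    unfolding gr_def by (rule bij_betw_reindex_direct_sum[where N = "?N i" and N' = "?N' i", OF e N])
  note ops = reindex_direct_sum_ops[where N = "?N i" and N' = "?N' i" for i,
      OF equalityD1[OF img] N, folded gr_def]
  have diff: "?r (gr_diff C d F I i \<xi>) = gr_diff C d F' J i (?r \<xi>)" for i \<xi>
    using img below by (auto simp: reindex_def gr_diff_def fun_eq_iff)
  have inj: "inj_on ?r (extensional I)" by (rule inj_on_reindex[OF img])
  \<comment> \<open>For arbitrary \<open>d\<close>, cosets of boundaries are only known to consist
    of extensional families; \<open>?r\<close> is injective on these.\<close>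
  have add_ext: "\<xi> \<oplus>\<^bsub>gr C F I i\<^esub> \<eta> \<in> extensional I" for i \<xi> \<eta>
    by (simp add: gr_def direct_sum_def)
  \<comment> \<open>Both sides of the equation are extensional, so \<open>?r\<close> detects
    vanishing and matches cocycles with cocycles.\<close>
  have zero_iff: "gr_diff C d F I i \<xi> = \<zero>\<^bsub>gr C F I (i + 1)\<^esub>
      \<longleftrightarrow> gr_diff C d F' J i (?r \<xi>) = \<zero>\<^bsub>gr C F' J (i + 1)\<^esub>" for i \<xi>
  proof -
    have "gr_diff C d F I i \<xi> = \<zero>\<^bsub>gr C F I (i + 1)\<^esub>
        \<longleftrightarrow> ?r (gr_diff C d F I i \<xi>) = ?r \<zero>\<^bsub>gr C F I (i + 1)\<^esub>"
      by (rule inj_on_eq_iff[OF inj, symmetric]) (simp_all add: gr_diff_def gr_def direct_sum_def)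
    then show ?thesis by (simp add: ops diff)
  qed
  let ?Z = "\<lambda>i. (gr C F I i)\<lparr>carrier := {\<xi> \<in> carrier (gr C F I i).
      gr_diff C d F I i \<xi> = \<zero>\<^bsub>gr C F I (i + 1)\<^esub>}\<rparr>"
  let ?Z' = "\<lambda>i. (gr C F' J i)\<lparr>carrier := {\<xi> \<in> carrier (gr C F' J i).
      gr_diff C d F' J i \<xi> = \<zero>\<^bsub>gr C F' J (i + 1)\<^esub>}\<rparr>"
  have bij_Z: "bij_betw ?r (carrier (?Z i)) (carrier (?Z' i))"
    using bij[of i] by (auto simp: bij_betw_def inj_on_def zero_iff)
  let ?B = "gr_diff C d F I (i - 1) ` carrier (gr C F I (i - 1))"
  let ?B' = "gr_diff C d F' J (i - 1) ` carrier (gr C F' J (i - 1))"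
  have B: "?r ` ?B = ?B'"
    unfolding bij_betw_imp_surj_on[OF bij, symmetric] by (simp add: image_image diff)
  have iso: "linear_iso (quotient_module (?Z i) ?B) (quotient_module (?Z' i) (?r ` ?B)) ((`) ?r)"
    and ext: "\<Union> (carrier (quotient_module (?Z i) ?B)) \<subseteq> extensional I"
    using linear_iso_quotient_module[where r = ?r and M = "?Z i" and N = "?Z' i" and U = ?B,
        OF bij_Z _ _ inj] ops add_ext by simp_all
  show lin: "linear_iso (gr_cohomology C d F I i) (gr_cohomology C d F' J i) ((`) ?r)"
    using iso unfolding B by (simp add: gr_cohomology_def cohomology_def)
  assume k: "k \<in> J"
  \<comment> \<open>\<open>filt_below\<close> is the zero coset of its degree and is the same set at
    \<open>l\<close> and \<open>e l\<close>, so concentration in degree \<open>e k\<close> becomes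
    concentration in degree \<open>k\<close>.\<close>
  have conc: "(\<forall>b\<in>I - {e k}. \<xi> b = filt_below (C i) (F i) I b)
      \<longleftrightarrow> (\<forall>l\<in>J - {k}. ?r \<xi> l = filt_below (C i) (F' i) J l)" for \<xi>
  proof -
    have "I - {e k} = e ` (J - {k})" using e k by (auto simp: bij_betw_def inj_on_def)
    then show ?thesis by (simp add: below reindex_def)
  qed
  have car: "carrier (gr_cohomology C d F' J i) = (`) ?r ` carrier (gr_cohomology C d F I i)"
    using lin by (simp add: linear_iso_def bij_betw_def)
  show "(`) ?r ` gr_cohomology_part C d F I i (e k) = gr_cohomology_part C d F' J i k"
    unfolding gr_cohomology_part_def car conc by auto
qed

text \<open>With a single puncture the sum in \<open>lattice_class\<close> has one term, so
  \<open>b\<close> and the integer \<open>b p\<close> name the same class.\<close>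

lemma MKh_filtration_annulus:
  assumes "a \<in> lattice_of {p}"
  shows "MKh_filtration {p} D j i a = AKh_filtration p D j i (a p)"
proof -
  let ?c = "\<lambda>k. H1_class {p} (frag_cmul k (frag_of (loop_simplex (puncture_loop {p} p))))"
  have "(\<exists>b\<in>lattice_of {p}. s = lattice_class {p} b \<and> b \<le> a) \<longleftrightarrow> (\<exists>k. s = ?c k \<and> k \<le> a p)" for s
  proof
    assume "\<exists>b\<in>lattice_of {p}. s = lattice_class {p} b \<and> b \<le> a"
    then show "\<exists>k. s = ?c k \<and> k \<le> a p" by (auto simp: lattice_class_def le_fun_def)
  next
    assume "\<exists>k. s = ?c k \<and> k \<le> a p"
    then obtain k where "s = ?c k" "k \<le> a p" by blast
    then show "\<exists>b\<in>lattice_of {p}. s = lattice_class {p} b \<and> b \<le> a"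
      using assms
      \<comment> \<open>The integer \<open>k\<close> is extended by zero; off \<open>p\<close> the
        comparison with \<open>a\<close> holds because \<open>a\<close> vanishes there.\<close>
      by (intro bexI[of _ "(\<lambda>q. 0)(p := k)"]) (auto simp: lattice_of_def lattice_class_def le_fun_def)
  qed
  then show ?thesis by (simp add: MKh_filtration_def AKh_filtration_def)
qed

theorem lemma6p2:
  fixes p :: complex and L :: link and D :: diagram
  assumes "p \<in> ball 0 1"
    and "is_link {p} L"
    and "is_diagram_of {p} D L"
  shows "\<exists>\<phi>. \<forall>i j. linear_iso (MKh {p} D i j) (AKh p D i j) (\<phi> i j) \<and>
           (\<forall>a\<in>lattice_of {p}. \<phi> i j ` MKh_part {p} D i j a = AKh_part p D i j (a p))"
proof -
  \<comment> \<open>The inverse of evaluation at \<open>p\<close>. It starts from the integers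
    because \<open>reindex\<close> precomposes, turning families over the lattice into families over
    the integers.\<close>
  define e :: "int \<Rightarrow> complex \<Rightarrow> int" where "e k = (\<lambda>q. 0)(p := k)" for k
  have e_lattice: "e k \<in> lattice_of {p}" and e_p: "e k p = k" for k
    by (auto simp: e_def lattice_of_def)
  have e_surj: "e (a p) = a" if "a \<in> lattice_of {p}" for a
    using that by (auto simp: e_def lattice_of_def)
  have e: "bij_betw e UNIV (lattice_of {p})"
    by (rule bij_betwI[where g = "\<lambda>a. a p"]) (auto simp: e_lattice e_p e_surj)
  have ord: "e k \<le> e l \<longleftrightarrow> k \<le> l" for k l by (auto simp: e_def le_fun_def)
  have F: "AKh_filtration p D j i k = MKh_filtration {p} D j i (e k)" for i j k
    by (simp add: MKh_filtration_annulus e_lattice e_p)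
  note reindexed = gr_cohomology_reindex[where F = "MKh_filtration {p} D j"
      and F' = "AKh_filtration p D j" for j, OF e ord F]
  have "linear_iso (MKh {p} D i j) (AKh p D i j) ((`) (reindex e UNIV))" for i j
    unfolding MKh_def AKh_def by (rule reindexed(1))
  moreover have "(`) (reindex e UNIV) ` MKh_part {p} D i j a = AKh_part p D i j (a p)"
    if "a \<in> lattice_of {p}" for i j a
    \<comment> \<open>Degree \<open>a\<close> is reached as \<open>e (a p)\<close>.\<close>
    using reindexed(2)[of "a p"] unfolding MKh_part_def AKh_part_def e_surj[OF that] by simp
  ultimately show ?thesis by (intro exI[of _ "\<lambda>i j. (`) (reindex e UNIV)"]) blast
qed

end
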